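(* Consider a feedforward ReLU network on a directed acyclic graph $G(V,E)$, with weights $\mathbf w\in\mathbb R^{|E|}$, and choose $R_v=\mathbb E\big[\mathbf h_{N^{\rm in}(v)}\mathbf h_{N^{\rm in}(v)}^\top\big]$ for each non-input node $v$. Then the DDP-SGD update $$w^{(t+1)}_{e}=w^{(t)}_{e}-\frac{\eta}{\kappa_{e}(\mathbf w^{(t)})}\frac{\partial L}{\partial w_{e}}(\mathbf w^{(t)}),\qquad \kappa_{e}(\mathbf w)=\frac12\frac{\partial^2\gamma^2_{\rm net}}{\partial w_{e}^2}(\mathbf w),\qquad e\in E,$$ is equivalent to the Diagonal Natural Gradient update $$w^{(t+1)}_{e}=w^{(t)}_{e}-\frac{\eta}{F(\mathbf w^{(t)})[e,e]}\frac{\partial L}{\partial w_{e}}(\mathbf w^{(t)}),\qquad F(\mathbf w)[e,e]=\mathbb E_{\mathbf x}\left[\sum_{v'\in V_{\rm out}}\left(\frac{\partial f_{\mathbf w}(\mathbf x)[v']}{\partial w_e}\right)^2\right],\qquad e\in E;$$ that is, $\kappa_e(\mathbf w)=F(\mathbf w)[e,e]$ for every edge $e\in E$ and every $\mathbf w$.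
   Context: Feedforward ReLU network: $G(V,E)$ is a finite directed acyclic graph; $V_{\rm in}$ is the set of input nodes (no incoming edges), $V_{\rm out}$ the set of output nodes (no outgoing edges), and all other nodes are internal. Each edge $(u\to v)$ carries a real weight $w_{u\to v}$. For input $\mathbf x\in\mathbb R^{|V_{\rm in}|}$: for $v\in V_{\rm in}$, $h_v$ is the corresponding coordinate of $\mathbf x$; for an internal node, $z_v=\sum_{(u\to v)\in E}w_{u\to v}h_u$ and $h_v=\max(z_v,0)$; for an output node, $z_v=\sum_{(u\to v)\in E}w_{u\to v}h_u$ and $f_{\mathbf w}(\mathbf x)[v]=z_v$. A bias may be modeled by an extra input node with output always $1$. $N^{\rm in}(v)=\{u:(u\to v)\in E\}$; $\mathbf h_{N^{\rm in}(v)}$ is the vector of outputs of the nodes in $N^{\rm in}(v)$ and $\mathbf w_{\to v}$ is the vector of weights $w_{u\to v}$, $u\in N^{\rm in}(v)$, so $z_v=\langle\mathbf w_{\to v},\mathbf h_{N^{\rm in}(v)}\rangle$. Expectations are over the data distribution ($\mathbf x$ from its marginal), with the second moments involved assumed finite. $L(\mathbf w)=\mathbb E[\ell(f_{\mathbf w}(\mathbf x),y)]$ is the objective, and $\eta>0$ is a step size. Complexity measure: $\gamma_v^2(\mathbf w)=\mathbf w_{\to v}^\top R_v\mathbf w_{\to v}$ and $\gamma^2_{\rm net}(\mathbf w)=\sum_{v\in V_{\rm out}}\gamma_v^2(\mathbf w)$. The matrix $R_v$ itself depends on the weights $\mathbf w$ through $\mathbf h_{N^{\rm in}(v)}$, and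 this dependence is included when differentiating $\gamma^2_{\rm net}$ (so with the choice $R_v=\mathbb E\big[\mathbf h_{N^{\rm in}(v)}\mathbf h_{N^{\rm in}(v)}^\top\big]$ for each non-input node $v$, one has $\gamma_v^2(\mathbf w)=\mathbb E[z_v^2]$). DDP-SGD is the update obtained by minimizing $\eta\langle\nabla L(\mathbf w^{(t)}),\mathbf w-\mathbf w^{(t)}\rangle+\frac12\sum_{e\in E}\frac12\frac{\partial^2\gamma_{\rm net}^2}{\partial w_e^2}(\mathbf w^{(t)})(w_e-w_e^{(t)})^2$ over $\mathbf w$, whose solution is $w^{(t+1)}_{e}=w^{(t)}_{e}-\frac{\eta}{\kappa_{e}(\mathbf w^{(t)})}\frac{\partial L}{\partial w_{e}}(\mathbf w^{(t)})$ with $\kappa_{e}(\mathbf w)=\frac12\frac{\partial^2\gamma^2_{\rm net}}{\partial w_{e}^2}(\mathbf w)$, $e\in E$. $F(\mathbf w)[e,e]$ is the diagonal entry of the Fisher information matrix of the conditional model $\mathbf y\mid\mathbf x\sim\mathcal N(f_{\mathbf w}(\mathbf x),I_{|V_{\rm out}|})$. Convention on derivatives: in $\kappa_e$ and in $F(\mathbf w)[e,e]$, derivatives with respect to the weights are taken inside the expectation, for each fixed $\mathbf x$, with the activation pattern of the ReLU units (which internal units $u$ have $z_u>0$) regarded as constant at its value at the current $\mathbf w$. Thus $\partial h_u/\partial z_u=1$ if $z_u>0$ and $0$ otherwise, and this indicator is treated as constant under further differentiation. The updates are considered where their denominators are nonzero. *)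

theory Defs
  imports "HOL-Probability.Probability"
begin

text \<open>
  A graph is given by a node set \<open>V\<close> and an edge relation \<open>E\<close>. Inputs and weights are total
  functions; only the coordinates in \<open>in_nodes V E\<close> and in \<open>E\<close>, respectively, matter.
\<close>

type_synonym 'v weights = "'v \<times> 'v \<Rightarrow> real"

definition in_nodes :: "'v set \<Rightarrow> ('v \<times> 'v) set \<Rightarrow> 'v set" where
  "in_nodes V E = {v \<in> V. \<forall>u. (u, v) \<notin> E}"

definition out_nodes :: "'v set \<Rightarrow> ('v \<times> 'v) set \<Rightarrow> 'v set" where
  "out_nodes V E = {v \<in> V. \<forall>u. (v, u) \<notin> E}"

definition nbr_in :: "('v \<times> 'v) set \<Rightarrow> 'v \<Rightarrow> 'v set" where
  "nbr_in E v = {u. (u, v) \<in> E}"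

text \<open>
  The forward pass, for an arbitrary node-dependent activation function \<open>\<sigma>\<close>. It is defined by
  well-founded recursion along \<open>E\<close>, which is meaningful when \<open>E\<close> is finite and acyclic; see
  \<open>hval_input\<close> and \<open>hval_noninput\<close> below. The value of \<open>hval\<close> at an output node with
  incoming edges is never used.
\<close>

definition hval ::
  "('v \<Rightarrow> real \<Rightarrow> real) \<Rightarrow> ('v \<times> 'v) set \<Rightarrow> 'v weights \<Rightarrow> ('v \<Rightarrow> real) \<Rightarrow> 'v \<Rightarrow> real" where
  "hval \<sigma> E w x =
     wfrec E (\<lambda>h v. if nbr_in E v = {} then x v
                    else \<sigma> v (\<Sum>u\<in>nbr_in E v. w (u, v) * h u))"

definition zval ::
  "('v \<Rightarrow> real \<Rightarrow> real) \<Rightarrow> ('v \<times> 'v) set \<Rightarrow> 'v weights \<Rightarrow> ('v \<Rightarrow> real) \<Rightarrow> 'v \<Rightarrow> real" where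
  "zval \<sigma> E w x v = (\<Sum>u\<in>nbr_in E v. w (u, v) * hval \<sigma> E w x u)"

definition relu :: "'v \<Rightarrow> real \<Rightarrow> real" where
  "relu v z = max z 0"

text \<open>
  The activation pattern of the ReLU network with weights \<open>w\<close> on input \<open>x\<close>, held constant:
  \<open>zval (frozen E w x) E w' x\<close> is the forward pass with weights \<open>w'\<close> in which a unit is the
  identity if it is active at \<open>w\<close>, and zero otherwise. At \<open>w' = w\<close> it agrees with the ReLU
  network (\<open>hval_frozen\<close> below). Differentiating in \<open>w'\<close> at \<open>w' = w\<close> is thus differentiating
  with the activation pattern regarded as constant.
\<close>

definition frozen ::
  "('v \<times> 'v) set \<Rightarrow> 'v weights \<Rightarrow> ('v \<Rightarrow> real) \<Rightarrow> 'v \<Rightarrow> real \<Rightarrow> real" where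
  "frozen E w x v z = (if zval relu E w x v > 0 then z else 0)"

definition network_output ::
  "'v set \<Rightarrow> ('v \<times> 'v) set \<Rightarrow> 'v weights \<Rightarrow> ('v \<Rightarrow> real) \<Rightarrow> 'v \<Rightarrow> real" where
  "network_output V E w x = (\<lambda>v\<in>out_nodes V E. zval relu E w x v)"

definition partial_deriv :: "('v weights \<Rightarrow> real) \<Rightarrow> 'v \<times> 'v \<Rightarrow> 'v weights \<Rightarrow> real" where
  "partial_deriv g e w = deriv (\<lambda>t. g (w(e := t))) (w e)"

text \<open>In the following, \<open>M\<close> is the distribution of the input \<open>x\<close>.\<close>

definition quad_form :: "('v \<times> 'v) set \<Rightarrow> 'v weights \<Rightarrow> 'v \<Rightarrow> ('v \<Rightarrow> 'v \<Rightarrow> real) \<Rightarrow> real" where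
  "quad_form E w v R = (\<Sum>u\<in>nbr_in E v. \<Sum>u'\<in>nbr_in E v. w (u, v) * R u u' * w (u', v))"

definition second_moment ::
  "('v \<times> 'v) set \<Rightarrow> ('v \<Rightarrow> real) measure \<Rightarrow> 'v weights \<Rightarrow> 'v \<Rightarrow> 'v \<Rightarrow> real" where
  "second_moment E M w u u' = (\<integral>x. hval relu E w x u * hval relu E w x u' \<partial>M)"

definition gamma_net_sq ::
  "'v set \<Rightarrow> ('v \<times> 'v) set \<Rightarrow> ('v \<Rightarrow> real) measure \<Rightarrow> 'v weights \<Rightarrow> real" where
  "gamma_net_sq V E M w = (\<Sum>v\<in>out_nodes V E. quad_form E w v (second_moment E M w))"

text \<open>
  The integrand of \<open>gamma_net_sq\<close>: the same quadratic forms with \<open>h h\<^sup>T\<close> for a single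
  input \<open>x\<close> in place of its expectation.
\<close>

definition gamma_net_sq_at ::
  "('v \<Rightarrow> real \<Rightarrow> real) \<Rightarrow> 'v set \<Rightarrow> ('v \<times> 'v) set \<Rightarrow> ('v \<Rightarrow> real) \<Rightarrow> 'v weights \<Rightarrow> real" where
  "gamma_net_sq_at \<sigma> V E x w =
     (\<Sum>v\<in>out_nodes V E. quad_form E w v (\<lambda>u u'. hval \<sigma> E w x u * hval \<sigma> E w x u'))"

text \<open>
  The second derivative is taken inside the expectation, with the activation pattern constant;
  the dependence of \<open>h\<close>, hence of the matrices, on the weights is differentiated.
\<close>

definition kappa ::
  "'v set \<Rightarrow> ('v \<times> 'v) set \<Rightarrow> ('v \<Rightarrow> real) measure \<Rightarrow> 'v \<times> 'v \<Rightarrow> 'v weights \<Rightarrow> real" where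
  "kappa V E M e w =
     1 / 2 * (\<integral>x. partial_deriv (partial_deriv (gamma_net_sq_at (frozen E w x) V E x) e) e w \<partial>M)"

text \<open>Identity covariance: the coordinates are independent with unit variance.\<close>

definition gauss_density :: "'v set \<Rightarrow> ('v \<Rightarrow> real) \<Rightarrow> ('v \<Rightarrow> real) \<Rightarrow> real" where
  "gauss_density I f y = (\<Prod>v\<in>I. normal_density (f v) 1 (y v))"

definition gauss_measure :: "'v set \<Rightarrow> ('v \<Rightarrow> real) \<Rightarrow> ('v \<Rightarrow> real) measure" where
  "gauss_measure I f = density (Pi\<^sub>M I (\<lambda>_. lborel)) (\<lambda>y. ennreal (gauss_density I f y))"

definition score ::
  "'v set \<Rightarrow> ('v \<times> 'v) set \<Rightarrow> 'v weights \<Rightarrow> ('v \<Rightarrow> real) \<Rightarrow> ('v \<Rightarrow> real) \<Rightarrow> 'v \<times> 'v \<Rightarrow> real" where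
  "score V E w x y e =
     partial_deriv (\<lambda>w'. ln (gauss_density (out_nodes V E) (zval (frozen E w x) E w' x) y)) e w"

definition fisher ::
  "'v set \<Rightarrow> ('v \<times> 'v) set \<Rightarrow> ('v \<Rightarrow> real) measure \<Rightarrow> 'v weights \<Rightarrow> 'v \<times> 'v \<Rightarrow> 'v \<times> 'v \<Rightarrow> real" where
  "fisher V E M w e e' =
     (\<integral>x. (\<integral>y. score V E w x y e * score V E w x y e'
              \<partial>gauss_measure (out_nodes V E) (network_output V E w x)) \<partial>M)"

text \<open>\<open>D\<close> is the joint distribution of inputs and labels, \<open>input_dist\<close> its input marginal.\<close>

definition input_dist ::
  "'v set \<Rightarrow> ('v \<times> 'v) set \<Rightarrow> (('v \<Rightarrow> real) \<times> 'y) measure \<Rightarrow> ('v \<Rightarrow> real) measure" where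
  "input_dist V E D = distr D (Pi\<^sub>M (in_nodes V E) (\<lambda>_. borel)) fst"

definition objective ::
  "'v set \<Rightarrow> ('v \<times> 'v) set \<Rightarrow> (('v \<Rightarrow> real) \<times> 'y) measure \<Rightarrow>
   (('v \<Rightarrow> real) \<Rightarrow> 'y \<Rightarrow> real) \<Rightarrow> 'v weights \<Rightarrow> real" where
  "objective V E D loss w = (\<integral>(x, y). loss (network_output V E w x) y \<partial>D)"

definition ddp_sgd_update ::
  "'v set \<Rightarrow> ('v \<times> 'v) set \<Rightarrow> (('v \<Rightarrow> real) \<times> 'y) measure \<Rightarrow>
   (('v \<Rightarrow> real) \<Rightarrow> 'y \<Rightarrow> real) \<Rightarrow> real \<Rightarrow> 'v weights \<Rightarrow> 'v weights" where
  "ddp_sgd_update V E D loss \<eta> w =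
     (\<lambda>e. w e - \<eta> / kappa V E (input_dist V E D) e w * partial_deriv (objective V E D loss) e w)"

definition diag_natural_gradient_update ::
  "'v set \<Rightarrow> ('v \<times> 'v) set \<Rightarrow> (('v \<Rightarrow> real) \<times> 'y) measure \<Rightarrow>
   (('v \<Rightarrow> real) \<Rightarrow> 'y \<Rightarrow> real) \<Rightarrow> real \<Rightarrow> 'v weights \<Rightarrow> 'v weights" where
  "diag_natural_gradient_update V E D loss \<eta> w =
     (\<lambda>e. w e - \<eta> / fisher V E (input_dist V E D) w e e * partial_deriv (objective V E D loss) e w)"

lemma hval_unfold:
  assumes "finite E" "acyclic E"
  shows "hval \<sigma> E w x v = (if nbr_in E v = {} then x v else \<sigma> v (zval \<sigma> E w x v))"
proof -
  have wf: "wf E"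
    using assms by (rule finite_acyclic_wf)
  have "(\<Sum>u\<in>nbr_in E v. w (u, v) * cut (hval \<sigma> E w x) E v u) = zval \<sigma> E w x v"
    unfolding zval_def by (rule sum.cong) (auto simp: nbr_in_def cut_apply)
  then show ?thesis
    unfolding hval_def by (subst wfrec[OF wf]) (simp cong: if_cong)
qed

lemma hval_input:
  assumes "finite E" "acyclic E" "v \<in> in_nodes V E"
  shows "hval \<sigma> E w x v = x v"
  using assms by (simp add: hval_unfold in_nodes_def nbr_in_def)

lemma hval_noninput:
  assumes "finite E" "acyclic E" "v \<in> V" "v \<notin> in_nodes V E"
  shows "hval \<sigma> E w x v = \<sigma> v (zval \<sigma> E w x v)"
  using assms by (auto simp: hval_unfold in_nodes_def nbr_in_def)

lemma hval_frozen:
  assumes "finite E" "acyclic E"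
  shows "hval (frozen E w x) E w x v = hval relu E w x v"
proof (induction v rule: wf_induct_rule[OF finite_acyclic_wf[OF assms]])
  case (1 v)
  then have "zval (frozen E w x) E w x v = zval relu E w x v"
    by (simp add: zval_def nbr_in_def)
  then show ?case
    unfolding hval_unfold[OF assms, of _ w x v] by (simp add: frozen_def[of E w x v] relu_def[of v])
qed

lemma gamma_net_sq_at_eq_sum_sq:
  "gamma_net_sq_at \<sigma> V E x w = (\<Sum>v\<in>out_nodes V E. (zval \<sigma> E w x v)\<^sup>2)"
  by (simp add: gamma_net_sq_at_def quad_form_def zval_def power2_eq_square sum_product ac_simps)

end

theory Submission
  imports Defs
begin

text \<open>
  With the activation pattern frozen, every \<open>z\<^sub>v\<close> is affine in each single weight \<open>w\<^sub>e\<close>, because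
  a path in an acyclic graph uses the edge \<open>e\<close> at most once. Hence \<open>z\<^sub>v\<^sup>2\<close> is a quadratic polynomial
  in \<open>w\<^sub>e\<close> with leading coefficient \<open>(\<partial>z\<^sub>v / \<partial>w\<^sub>e)\<^sup>2\<close>, and half the second derivative of
  \<open>\<Sum>\<^sub>v z\<^sub>v\<^sup>2\<close> is \<open>\<Sum>\<^sub>v (\<partial>z\<^sub>v / \<partial>w\<^sub>e)\<^sup>2\<close>. This is also the second moment of the score
  \<open>\<Sum>\<^sub>v (y\<^sub>v - z\<^sub>v) \<partial>z\<^sub>v / \<partial>w\<^sub>e\<close>, since the residuals \<open>y\<^sub>v - z\<^sub>v\<close> are uncorrelated with unit
  variance.
\<close>

section \<open>Dependence of the forward pass on a single weight\<close>

text \<open>The weight of \<open>(p, q)\<close> enters the forward pass only through the sum at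
  \<open>q\<close>. If \<open>q\<close> does not reach \<open>v\<close>, then \<open>v\<close>
  differs from \<open>q\<close> and \<open>q\<close> reaches no predecessor of \<open>v\<close>, so
  induction along \<open>E\<close> applies.\<close>

lemma hval_upd_not_reachable:
  assumes "finite E" "acyclic E" "(q, v) \<notin> E\<^sup>*"
  shows "hval \<sigma> E (w((p, q) := t)) x v = hval \<sigma> E w x v"
  using assms(3)
proof (induction v rule: wf_induct_rule[OF finite_acyclic_wf[OF assms(1,2)]])
  case (1 v)
  have "hval \<sigma> E (w((p, q) := t)) x u = hval \<sigma> E w x u" if "(u, v) \<in> E" for u
    using 1 that by (meson rtrancl.rtrancl_into_rtrancl)
  moreover have "v \<noteq> q"
    using 1(2) by auto
  ultimately have "zval \<sigma> E (w((p, q) := t)) x v = zval \<sigma> E w x v"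
    unfolding zval_def by (intro sum.cong) (auto simp: nbr_in_def)
  then show ?case
    by (simp only: hval_unfold[OF assms(1,2)])
qed

lemma affine_in_parameter_sum:
  fixes f :: "'a \<Rightarrow> real \<Rightarrow> real"
  assumes "\<And>u. u \<in> A \<Longrightarrow> \<exists>a b. \<forall>t. f u t = a + b * t"
  shows "\<exists>a b. \<forall>t. (\<Sum>u\<in>A. f u t) = a + b * t"
proof -
  obtain a b where "\<And>u t. u \<in> A \<Longrightarrow> f u t = a u + b u * t"
    using assms by metis
  then have "(\<Sum>u\<in>A. f u t) = (\<Sum>u\<in>A. a u) + (\<Sum>u\<in>A. b u) * t" for t
    by (simp add: sum.distrib sum_distrib_right)
  then show ?thesis
    by blast
qed

text \<open>Each summand is a weight times a unit output, and at most one of the two factors varies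
  with \<open>t\<close>. The step is stated apart from the induction because it also transfers the
  final result from \<open>hval\<close> to \<open>zval\<close>.\<close>

lemma zval_upd_affine_step:
  assumes "finite E" "acyclic E"
    and hval: "\<And>u. (u, v) \<in> E \<Longrightarrow> \<exists>a b. \<forall>t. hval \<sigma> E (w((p, q) := t)) x u = a + b * t"
  shows "\<exists>a b. \<forall>t. zval \<sigma> E (w((p, q) := t)) x v = a + b * t"
  unfolding zval_def
proof (rule affine_in_parameter_sum)
  fix u assume "u \<in> nbr_in E v"
  then have uv: "(u, v) \<in> E"
    by (simp add: nbr_in_def)
  show "\<exists>a b. \<forall>t. (w((p, q) := t)) (u, v) * hval \<sigma> E (w((p, q) := t)) x u = a + b * t"
  proof (cases "(u, v) = (p, q)")
    case True
    \<comment> \<open>A path from \<open>q\<close> back to \<open>u = p\<close> would close a cycle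
      with the edge \<open>(p, q)\<close>; so the output of \<open>u\<close> is constant in
      \<open>t\<close> and no term in the square of \<open>t\<close> arises.\<close>
    then have "(q, u) \<notin> E\<^sup>*"
      using uv assms(2) by (metis acyclic_def prod.inject rtrancl_into_trancl1)
    from hval_upd_not_reachable[OF assms(1,2) this]
    have "(w((p, q) := t)) (u, v) * hval \<sigma> E (w((p, q) := t)) x u = 0 + hval \<sigma> E w x u * t" for t
      using True by simp
    then show ?thesis
      by blast
  next
    case False
    obtain a b where "\<And>t. hval \<sigma> E (w((p, q) := t)) x u = a + b * t"
      using hval[OF uv] by blast
    then have "(w((p, q) := t)) (u, v) * hval \<sigma> E (w((p, q) := t)) x u
        = w (u, v) * a + (w (u, v) * b) * t" for t
      unfolding fun_upd_other[OF False] by (simp add: algebra_simps)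
    then show ?thesis
      by blast
  qed
qed

text \<open>The slope \<open>c v\<close> may depend on the node but not on the weights. This is the
  form of a frozen ReLU, whereas ReLU itself is only piecewise linear.\<close>

lemma hval_upd_affine:
  assumes "finite E" "acyclic E" and lin: "\<And>v z. \<sigma> v z = c v * z"
  shows "\<exists>a b. \<forall>t. hval \<sigma> E (w((p, q) := t)) x v = a + b * t"
proof (induction v rule: wf_induct_rule[OF finite_acyclic_wf[OF assms(1,2)]])
  case (1 v)
  obtain a b where "\<And>t. zval \<sigma> E (w((p, q) := t)) x v = a + b * t"
    using zval_upd_affine_step[OF assms(1,2) 1] by blast
  then have "hval \<sigma> E (w((p, q) := t)) x v
      = (if nbr_in E v = {} then x v else c v * a) + (if nbr_in E v = {} then 0 else c v * b) * t" for t
    by (simp add: hval_unfold[OF assms(1,2)] lin algebra_simps)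
  then show ?case
    by blast
qed

lemma zval_upd_affine:
  assumes "finite E" "acyclic E" and "\<And>v z. \<sigma> v z = c v * z"
  shows "\<exists>a b. \<forall>t. zval \<sigma> E (w(e := t)) x v = a + b * t"
  by (cases e, hypsubst) (rule zval_upd_affine_step[OF assms(1,2) hval_upd_affine[OF assms]])

text \<open>The pattern is fixed by \<open>w\<close>, so the slopes 0 and 1 stay put while
  \<open>w'\<close> moves. The coefficients become functions of the node, ready for sums over output
  nodes.\<close>

lemma zval_frozen_upd_affine:
  assumes "finite E" "acyclic E"
  obtains a b where "\<And>v t. zval (frozen E w x) E (w'(e := t)) x v = a v + b v * t"
proof -
  have "frozen E w x v z = of_bool (zval relu E w x v > 0) * z" for v z
    by (simp add: frozen_def)
  then have "\<forall>v. \<exists>a b. \<forall>t. zval (frozen E w x) E (w'(e := t)) x v = a + b * t"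
    by (intro allI zval_upd_affine[OF assms,
      where \<sigma> = "frozen E w x" and c = "\<lambda>v. of_bool (zval relu E w x v > 0)"])
  then obtain a b where "\<forall>v t. zval (frozen E w x) E (w'(e := t)) x v = a v + b v * t"
    unfolding choice_iff by blast
  then show ?thesis
    using that by blast
qed

lemma zval_frozen:
  assumes "finite E" "acyclic E"
  shows "zval (frozen E w x) E w x v = zval relu E w x v"
  by (simp add: zval_def hval_frozen[OF assms])

section \<open>Derivatives along a single weight\<close>

lemma partial_deriv_affine:
  assumes "\<And>t. g (w(e := t)) = a + b * t"
  shows "partial_deriv g e w = b"
  unfolding partial_deriv_def assms
  by (rule DERIV_imp_deriv) (auto intro!: derivative_eq_intros)

text \<open>The inner derivative is computed at every point \<open>w(e := t)\<close> of the line. It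
  is again affine in \<open>t\<close>, and its slope is the second derivative.\<close>

lemma partial_deriv_twice_sum_affine_sq:
  assumes "\<And>v t. f (w(e := t)) v = a v + b v * t"
  shows "partial_deriv (partial_deriv (\<lambda>w. \<Sum>v\<in>A. (f w v)\<^sup>2) e) e w = 2 * (\<Sum>v\<in>A. (b v)\<^sup>2)"
proof -
  have "partial_deriv (\<lambda>w. \<Sum>v\<in>A. (f w v)\<^sup>2) e (w(e := t))
      = (\<Sum>v\<in>A. 2 * a v * b v) + (2 * (\<Sum>v\<in>A. (b v)\<^sup>2)) * t" for t
  proof -
    have "((\<lambda>s. \<Sum>v\<in>A. (a v + b v * s)\<^sup>2) has_real_derivative
        (\<Sum>v\<in>A. 2 * (a v + b v * t) * b v)) (at t)"
      by (auto intro!: derivative_eq_intros sum.cong)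
    also have "(\<Sum>v\<in>A. 2 * (a v + b v * t) * b v)
        = (\<Sum>v\<in>A. 2 * a v * b v + 2 * (b v)\<^sup>2 * t)"
      by (simp add: power2_eq_square algebra_simps)
    also have "\<dots> = (\<Sum>v\<in>A. 2 * a v * b v) + (2 * (\<Sum>v\<in>A. (b v)\<^sup>2)) * t"
      by (simp only: sum.distrib sum_distrib_left sum_distrib_right)
    finally show ?thesis
      unfolding partial_deriv_def fun_upd_upd assms fun_upd_same by (rule DERIV_imp_deriv)
  qed
  then show ?thesis
    by (rule partial_deriv_affine)
qed

section \<open>Moments of the isotropic Gaussian\<close>

text \<open>The density times the residual product factors over coordinates, so Fubini reduces
  variance and covariance alike to one-dimensional central moments.\<close>

lemma gauss_residual_product:
  assumes "finite I" "v \<in> I" "v' \<in> I"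
  shows "has_bochner_integral (gauss_measure I f) (\<lambda>y. (y v - f v) * (y v' - f v'))
    (of_bool (v = v'))"
proof -
  interpret product_sigma_finite "\<lambda>_. lborel :: real measure" ..
  \<comment> \<open>\<open>k i\<close> counts how often \<open>i\<close> occurs among
    \<open>v\<close> and \<open>v'\<close>, which treats equal and distinct indices
    uniformly.\<close>
  define k :: "'a \<Rightarrow> nat" where "k i = of_bool (i = v) + of_bool (i = v')" for i
  let ?g = "\<lambda>i t. normal_density (f i) 1 t * (t - f i) ^ k i"
  have k: "k i = 0 \<or> k i = 1 \<or> k i = 2" for i
    by (auto simp: k_def)
  \<comment> \<open>The central moments of order 0, 1, 2 of a unit-variance normal are 1, 0,
    1.\<close>
  have m: "integral\<^sup>L lborel (?g i) = of_bool (k i \<noteq> 1)" for i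
    using k[of i] integral_normal_moment_even[of 1 "f i" 0] integral_normal_moment_even[of 1 "f i" 1]
      integral_normal_moment_odd[of 1 "f i" 0]
    by auto
  have int: "integrable lborel (?g i)" for i
    by (rule integrable_normal_moment) simp
  have delta: "(\<Prod>i\<in>I. c i ^ of_bool (i = j)) = c j" if "j \<in> I" for c :: "'a \<Rightarrow> real" and j
  proof -
    have "(\<Prod>i\<in>I. c i ^ of_bool (i = j)) = (\<Prod>i\<in>I. if i = j then c i else 1)"
      by (rule prod.cong) auto
    then show ?thesis
      using assms(1) that by simp
  qed
  have "has_bochner_integral (Pi\<^sub>M I (\<lambda>_. lborel)) (\<lambda>y. \<Prod>i\<in>I. ?g i (y i))
      (\<Prod>i\<in>I. of_bool (k i \<noteq> 1))"
    unfolding has_bochner_integral_iff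
    using product_integrable_prod[OF assms(1), of ?g] product_integral_prod[OF assms(1), of ?g] int m
    by simp
  \<comment> \<open>An exponent 1, and with it a vanishing factor, occurs exactly when
    \<open>v\<close> and \<open>v'\<close> differ.\<close>
  moreover have "(\<Prod>i\<in>I. of_bool (k i \<noteq> 1)) = (of_bool (v = v') :: real)"
    using assms by (auto simp: k_def intro!: prod.neutral prod_zero)
  moreover have "(\<Prod>i\<in>I. ?g i (y i)) = gauss_density I f y *\<^sub>R ((y v - f v) * (y v' - f v'))" for y
    using assms
    by (simp add: gauss_density_def k_def prod.distrib power_add delta)
  ultimately have "has_bochner_integral (Pi\<^sub>M I (\<lambda>_. lborel))
      (\<lambda>y. gauss_density I f y *\<^sub>R ((y v - f v) * (y v' - f v'))) (of_bool (v = v'))"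
    by simp
  moreover have "(\<lambda>y. y i :: real) \<in> borel_measurable (Pi\<^sub>M I (\<lambda>_. lborel))" if "i \<in> I" for i
    using measurable_component_singleton[OF that, of "\<lambda>_. lborel :: real measure"] by simp
  ultimately show ?thesis
    unfolding gauss_measure_def using assms
    by (intro has_bochner_integral_density)
      (auto simp: gauss_density_def[abs_def] intro!: prod_nonneg)
qed

text \<open>Only the diagonal terms of the expanded square survive, because the residuals have
  identity covariance.\<close>

lemma gauss_residual_sum_sq:
  assumes "finite I"
  shows "(\<integral>y. (\<Sum>v\<in>I. (y v - f v) * b v)\<^sup>2 \<partial>gauss_measure I f) = (\<Sum>v\<in>I. (b v)\<^sup>2)"
proof -
  have "has_bochner_integral (gauss_measure I f)
      (\<lambda>y. \<Sum>v\<in>I. \<Sum>v'\<in>I. (y v - f v) * (y v' - f v') * (b v * b v'))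
      (\<Sum>v\<in>I. \<Sum>v'\<in>I. of_bool (v = v') * (b v * b v'))"
    by (intro has_bochner_integral_sum has_bochner_integral_mult_left gauss_residual_product assms)
  moreover have "(\<Sum>v\<in>I. \<Sum>v'\<in>I. of_bool (v = v') * (b v * b v')) = (\<Sum>v\<in>I. (b v)\<^sup>2)"
    using assms by (simp add: of_bool_def if_distrib[of "\<lambda>c. c * _"] power2_eq_square cong: if_cong)
  moreover have "(\<Sum>v\<in>I. (y v - f v) * b v)\<^sup>2
      = (\<Sum>v\<in>I. \<Sum>v'\<in>I. (y v - f v) * (y v' - f v') * (b v * b v'))" for y
    by (simp add: power2_eq_square sum_product ac_simps)
  ultimately show ?thesis
    by (simp add: has_bochner_integral_iff)
qed

section \<open>Score and diagonal Fisher information\<close>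

lemma ln_gauss_density:
  assumes "finite I"
  shows "ln (gauss_density I f y) = (\<Sum>v\<in>I. - (y v - f v)\<^sup>2 / 2 - ln (sqrt (2 * pi)))"
  unfolding gauss_density_def using assms
  by (subst ln_prod)
    (auto simp: normal_density_pos less_imp_neq[symmetric] normal_density_def ln_mult ln_div
      intro!: sum.cong)

text \<open>Reconciles \<open>network_output\<close>, which is restricted to the output nodes, with
  the unrestricted \<open>zval\<close> in the score.\<close>

lemma gauss_measure_restrict: "gauss_measure I (restrict f I) = gauss_measure I f"
  by (simp add: gauss_measure_def gauss_density_def cong: prod.cong)

lemma score_eq:
  assumes "finite V" "finite E" "acyclic E"
    and "\<And>v t. zval (frozen E w x) E (w(e := t)) x v = a v + b v * t"
  shows "score V E w x y e = (\<Sum>v\<in>out_nodes V E. (y v - zval relu E w x v) * b v)"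
proof -
  have z: "zval relu E w x v = a v + b v * w e" for v
    using assms(4)[of "w e" v] zval_frozen[OF assms(2,3), of w x v] by simp
  have "finite (out_nodes V E)"
    using assms(1) by (simp add: out_nodes_def)
  then show ?thesis
    unfolding score_def partial_deriv_def ln_gauss_density[OF \<open>finite (out_nodes V E)\<close>] assms(4) z
    by (intro DERIV_imp_deriv)
      (auto intro!: derivative_eq_intros sum.cong simp: field_simps)
qed

lemma integral_score_sq:
  assumes "finite V" "finite E" "acyclic E"
    and "\<And>v t. zval (frozen E w x) E (w(e := t)) x v = a v + b v * t"
  shows "(\<integral>y. score V E w x y e * score V E w x y e
              \<partial>gauss_measure (out_nodes V E) (network_output V E w x))
    = (\<Sum>v\<in>out_nodes V E. (b v)\<^sup>2)"
  using gauss_residual_sum_sq[of "out_nodes V E" "zval relu E w x" b] assms(1)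
  by (simp add: score_eq[OF assms] network_output_def gauss_measure_restrict out_nodes_def
      power2_eq_square)

section \<open>Square integrability of the unit outputs\<close>

lemma integrable_mult_of_squares:
  fixes f g :: "'a \<Rightarrow> real"
  assumes [measurable]: "f \<in> borel_measurable M" "g \<in> borel_measurable M"
    and "integrable M (\<lambda>x. (f x)\<^sup>2)" "integrable M (\<lambda>x. (g x)\<^sup>2)"
  shows "integrable M (\<lambda>x. f x * g x)"
proof (rule Bochner_Integration.integrable_bound)
  show "integrable M (\<lambda>x. (f x)\<^sup>2 + (g x)\<^sup>2)"
    using assms by simp
  have "\<bar>r * s\<bar> \<le> r\<^sup>2 + s\<^sup>2" for r s :: real
  proof -
    have "2 * \<bar>r * s\<bar> \<le> r\<^sup>2 + s\<^sup>2"
      using sum_squares_bound[of "\<bar>r\<bar>" "\<bar>s\<bar>"] by (simp add: abs_mult)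
    then show ?thesis
      by linarith
  qed
  then show "AE x in M. norm (f x * g x) \<le> norm ((f x)\<^sup>2 + (g x)\<^sup>2)"
    by simp
qed simp

text \<open>Square integrability spreads from the inputs along the edges: finite linear combinations
  preserve it, and ReLU does not increase absolute values. Measurability is carried along since
  integrability of the square does not imply it.\<close>

lemma hval_relu_square_integrable:
  assumes "finite V" "E \<subseteq> V \<times> V" "acyclic E"
    and sets: "sets M = sets (Pi\<^sub>M (in_nodes V E) (\<lambda>_. borel))"
    and inputs: "\<And>v. v \<in> in_nodes V E \<Longrightarrow> integrable M (\<lambda>x. (x v)\<^sup>2)"
    and "v \<in> V"
  shows "(\<lambda>x. hval relu E w x v) \<in> borel_measurable M \<and> integrable M (\<lambda>x. (hval relu E w x v)\<^sup>2)"
proof -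
  have fin: "finite E"
    using assms(1,2) by (meson finite_SigmaI finite_subset)
  show ?thesis
    using \<open>v \<in> V\<close>
  proof (induction v rule: wf_induct_rule[OF finite_acyclic_wf[OF fin assms(3)]])
    case (1 v)
    show ?case
    proof (cases "nbr_in E v = {}")
      case True
      then have v: "v \<in> in_nodes V E"
        using 1(2) by (auto simp: in_nodes_def nbr_in_def)
      have "(\<lambda>x. x v) \<in> borel_measurable M"
        using measurable_component_singleton[OF v, of "\<lambda>_. borel :: real measure"]
          measurable_cong_sets[OF sets refl] by blast
      then show ?thesis
        using True inputs[OF v] by (simp add: hval_unfold[OF fin assms(3)])
    next
      case False
      have nbr: "u \<in> nbr_in E v \<Longrightarrow> (u, v) \<in> E \<and> u \<in> V" for u
        using assms(2) by (auto simp: nbr_in_def)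
      have meas[measurable]: "(\<lambda>x. zval relu E w x v) \<in> borel_measurable M"
        unfolding zval_def using 1(1) nbr by (intro borel_measurable_sum borel_measurable_times) auto
      have eq: "(zval relu E w x v)\<^sup>2 = (\<Sum>u\<in>nbr_in E v. \<Sum>u'\<in>nbr_in E v.
          w (u, v) * w (u', v) * (hval relu E w x u * hval relu E w x u'))" for x
        by (simp add: zval_def power2_eq_square sum_product ac_simps)
      have int: "integrable M (\<lambda>x. (zval relu E w x v)\<^sup>2)"
        unfolding eq using 1(1) nbr
        by (intro Bochner_Integration.integrable_sum integrable_mult_right integrable_mult_of_squares) auto
      have h: "hval relu E w x v = max (zval relu E w x v) 0" for x
        using False by (simp add: hval_unfold[OF fin assms(3)] relu_def)
      have "integrable M (\<lambda>x. (max (zval relu E w x v) 0)\<^sup>2)"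
        by (rule Bochner_Integration.integrable_bound[OF int]) (auto simp: max_def)
      then show ?thesis
        by (simp add: h)
    qed
  qed
qed

text \<open>Here the finite second moments of the inputs enter: they make all products of unit
  outputs integrable, so that the finite sums may be moved inside the integral.\<close>

lemma gamma_net_sq_eq_integral:
  assumes "finite V" "E \<subseteq> V \<times> V" "acyclic E"
    and "sets M = sets (Pi\<^sub>M (in_nodes V E) (\<lambda>_. borel))"
    and "\<And>v. v \<in> in_nodes V E \<Longrightarrow> integrable M (\<lambda>x. (x v)\<^sup>2)"
  shows "gamma_net_sq V E M w = (\<integral>x. gamma_net_sq_at relu V E x w \<partial>M)"
proof -
  have "integrable M (\<lambda>x. hval relu E w x u * hval relu E w x u')"
    if "u \<in> nbr_in E v" "u' \<in> nbr_in E v" for u u' v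
    using that hval_relu_square_integrable[OF assms] assms(2)
    by (intro integrable_mult_of_squares) (auto simp: nbr_in_def)
  then show ?thesis
    by (simp add: gamma_net_sq_def gamma_net_sq_at_def quad_form_def second_moment_def
        Bochner_Integration.integral_sum)
qed

theorem theorem2:
  fixes V :: "'v set" and E :: "('v \<times> 'v) set"
    and D :: "(('v \<Rightarrow> real) \<times> 'y) measure" and N :: "'y measure"
    and loss :: "('v \<Rightarrow> real) \<Rightarrow> 'y \<Rightarrow> real" and \<eta> :: real
  assumes "finite V" and "E \<subseteq> V \<times> V" and "acyclic E"
    and "prob_space D" and "sets D = sets (Pi\<^sub>M (in_nodes V E) (\<lambda>_. borel) \<Otimes>\<^sub>M N)"
    and "\<And>v. v \<in> in_nodes V E \<Longrightarrow> integrable (input_dist V E D) (\<lambda>x. (x v)\<^sup>2)"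
    and "\<eta> > 0"
  shows "(\<forall>w. gamma_net_sq V E (input_dist V E D) w =
               (\<integral>x. gamma_net_sq_at (frozen E w x) V E x w \<partial>input_dist V E D)) \<and>
         (\<forall>w. \<forall>e\<in>E. fisher V E (input_dist V E D) w e e =
               (\<integral>x. (\<Sum>v\<in>out_nodes V E.
                      (partial_deriv (\<lambda>w'. zval (frozen E w x) E w' x v) e w)\<^sup>2) \<partial>input_dist V E D)) \<and>
         (\<forall>w. \<forall>e\<in>E. kappa V E (input_dist V E D) e w = fisher V E (input_dist V E D) w e e) \<and>
         (\<forall>w. \<forall>e\<in>E. ddp_sgd_update V E D loss \<eta> w e = diag_natural_gradient_update V E D loss \<eta> w e)"
proof -
  let ?M = "input_dist V E D"
  have fin: "finite E"
    using assms(1,2) by (meson finite_SigmaI finite_subset)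
  note ac = \<open>acyclic E\<close>
  have gamma: "gamma_net_sq V E ?M w = (\<integral>x. gamma_net_sq_at (frozen E w x) V E x w \<partial>?M)" for w
    using gamma_net_sq_eq_integral[OF assms(1-3) _ assms(6)]
    by (simp add: input_dist_def gamma_net_sq_at_eq_sum_sq zval_frozen[OF fin ac])
  \<comment> \<open>The integrands over \<open>x\<close> agree pointwise, the inner Gaussian
    integral being evaluated for each fixed input.\<close>
  have fisher: "fisher V E ?M w e e = (\<integral>x. (\<Sum>v\<in>out_nodes V E.
      (partial_deriv (\<lambda>w'. zval (frozen E w x) E w' x v) e w)\<^sup>2) \<partial>?M)" for w e
    unfolding fisher_def
  proof (rule Bochner_Integration.integral_cong[OF refl])
    fix x
    obtain a b where ab: "\<And>v t. zval (frozen E w x) E (w(e := t)) x v = a v + b v * t"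
      using zval_frozen_upd_affine[OF fin ac] by metis
    show "(\<integral>y. score V E w x y e * score V E w x y e
          \<partial>gauss_measure (out_nodes V E) (network_output V E w x))
        = (\<Sum>v\<in>out_nodes V E. (partial_deriv (\<lambda>w'. zval (frozen E w x) E w' x v) e w)\<^sup>2)"
      by (simp add: integral_score_sq[OF assms(1) fin ac ab] partial_deriv_affine[OF ab])
  qed
  \<comment> \<open>Again the comparison is made for each \<open>x\<close>; the factor 2 from
    differentiating a square twice cancels the \<open>1 / 2\<close> in \<open>kappa\<close>.\<close>
  have kappa: "kappa V E ?M e w = fisher V E ?M w e e" for w e
  proof -
    have "partial_deriv (partial_deriv (gamma_net_sq_at (frozen E w x) V E x) e) e w
        = 2 * (\<Sum>v\<in>out_nodes V E. (partial_deriv (\<lambda>w'. zval (frozen E w x) E w' x v) e w)\<^sup>2)" for x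
    proof -
      obtain a b where ab: "\<And>v t. zval (frozen E w x) E (w(e := t)) x v = a v + b v * t"
        using zval_frozen_upd_affine[OF fin ac] by metis
      show ?thesis
        using partial_deriv_twice_sum_affine_sq[of "\<lambda>w'. zval (frozen E w x) E w' x", OF ab]
        by (simp add: gamma_net_sq_at_eq_sum_sq[abs_def] partial_deriv_affine[OF ab])
    qed
    then show ?thesis
      by (simp add: kappa_def fisher)
  qed
  show ?thesis
    using gamma fisher kappa by (simp add: ddp_sgd_update_def diag_natural_gradient_update_def)
qed

end
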